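(* Let $G$ be a finite abelian CI-group having a Sylow subgroup isomorphic to $\mathbb{Z}_4$, $\mathbb{Z}_8$ or $\mathbb{Z}_9$. Then $G$ does not have the $k$-if property for any integer $k\geq2$.
   Context: For a finite group $G$ let $G^*=G\setminus\{1\}$. For an inverse-closed $S\subseteq G^*$, $\mathrm{Cay}(G,S)$ has vertex set $G$ and edges $\{h,g\}$ with $gh^{-1}\in S$. $G$ is a CI-group if for all inverse-closed $S,T\subseteq G^*$, $\mathrm{Cay}(G,S)\cong\mathrm{Cay}(G,T)$ implies $T=S^{\alpha}$ for some $\alpha\in\mathrm{Aut}(G)$. A partition of a set is a collection of non-empty pairwise disjoint subsets whose union is the set. $\mathrm{Cay}(G,S)$ is a $k$-if Cayley graph if there is a partition $\{S_0=S,\dots,S_{k-1}\}$ of $G^*$ into inverse-closed subsets with $\mathrm{Cay}(G,S_i)\cong\mathrm{Cay}(G,S)$ for all $i$; $G$ has the $k$-if property if some $\mathrm{Cay}(G,S)$ is a $k$-if Cayley graph. *)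

theory Defs
  imports "HOL-Algebra.Algebra" "HOL-Library.Disjoint_Sets"
begin

text \<open>Undirected graphs: a vertex set together with a set of edges \<open>{u, v}\<close>.\<close>

type_synonym 'v ugraph = "'v set \<times> 'v set set"

definition graph_iso :: "'v ugraph \<Rightarrow> 'w ugraph \<Rightarrow> bool" where
  "graph_iso \<Gamma> \<Delta> \<longleftrightarrow>
     (\<exists>f. bij_betw f (fst \<Gamma>) (fst \<Delta>) \<and>
          (\<forall>u\<in>fst \<Gamma>. \<forall>v\<in>fst \<Gamma>. {u, v} \<in> snd \<Gamma> \<longleftrightarrow> {f u, f v} \<in> snd \<Delta>))"

definition nonidentity :: "('a, 'b) monoid_scheme \<Rightarrow> 'a set" where
  "nonidentity G = carrier G - {\<one>\<^bsub>G\<^esub>}"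

definition inverse_closed :: "('a, 'b) monoid_scheme \<Rightarrow> 'a set \<Rightarrow> bool" where
  "inverse_closed G S \<longleftrightarrow> (\<forall>x\<in>S. inv\<^bsub>G\<^esub> x \<in> S)"

definition Cay :: "('a, 'b) monoid_scheme \<Rightarrow> 'a set \<Rightarrow> 'a ugraph" where
  "Cay G S =
     (carrier G,
      {{h, g} | h g. h \<in> carrier G \<and> g \<in> carrier G \<and> g \<otimes>\<^bsub>G\<^esub> inv\<^bsub>G\<^esub> h \<in> S})"

definition CI_group :: "('a, 'b) monoid_scheme \<Rightarrow> bool" where
  "CI_group G \<longleftrightarrow>
     group G \<and> finite (carrier G) \<and>
     (\<forall>S T. S \<subseteq> nonidentity G \<and> inverse_closed G S \<and>
            T \<subseteq> nonidentity G \<and> inverse_closed G T \<and>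
            graph_iso (Cay G S) (Cay G T) \<longrightarrow>
            (\<exists>\<alpha>\<in>auto G. T = \<alpha> ` S))"

text \<open>
  The family \<open>S\<^sub>0, \<dots>, S\<^sub>k\<^sub>-\<^sub>1\<close> is given as a set \<open>P\<close> of exactly \<open>k\<close> blocks, one of
  which is \<open>S\<close>; since all blocks are nonempty and disjoint, listing them with \<open>S\<close> first
  carries no further information.
\<close>

definition k_if_Cayley :: "nat \<Rightarrow> ('a, 'b) monoid_scheme \<Rightarrow> 'a set \<Rightarrow> bool" where
  "k_if_Cayley k G S \<longleftrightarrow>
     (\<exists>P. partition_on (nonidentity G) P \<and> finite P \<and> card P = k \<and> S \<in> P \<and>
          (\<forall>T\<in>P. inverse_closed G T \<and> graph_iso (Cay G T) (Cay G S)))"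

definition has_k_if_property :: "nat \<Rightarrow> ('a, 'b) monoid_scheme \<Rightarrow> bool" where
  "has_k_if_property k G \<longleftrightarrow>
     (\<exists>S. S \<subseteq> nonidentity G \<and> inverse_closed G S \<and> k_if_Cayley k G S)"

text \<open>Sylow subgroups are taken for primes \<open>p\<close> and have the full \<open>p\<close>-part of the group order as order.\<close>

definition sylow_subgroup :: "nat \<Rightarrow> 'a set \<Rightarrow> ('a, 'b) monoid_scheme \<Rightarrow> bool" where
  "sylow_subgroup p H G \<longleftrightarrow>
     Factorial_Ring.prime p \<and> subgroup H G \<and> card H = p ^ multiplicity p (order G)"

end

theory Submission
  imports Defs
begin

text \<open>
  The CI property turns the isomorphic blocks of a partition of \<open>G\<^sup>*\<close> into images of a single
  block \<open>S\<close> under automorphisms. The Sylow condition makes \<open>G\<close> have a unique subgroup of order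
  \<open>p \<le> 3\<close>, generated by some \<open>t\<close>, so every automorphism maps \<open>t\<close> into \<open>{t, t\<^sup>-\<^sup>1}\<close>. As the blocks
  are inverse-closed, \<open>t\<close> then lies in all of them or in none, so there is only one block.
\<close>

text \<open>By injectivity, \<open>t\<close> lies in the image of \<open>B\<close> exactly when its
  preimage lies in \<open>B\<close>. That preimage is \<open>t\<close> or \<open>inv t\<close>, and
  \<open>B\<close> contains both or neither.\<close>

lemma (in group) mem_auto_image_iff:
  assumes \<alpha>: "\<alpha> \<in> auto G" and B: "inverse_closed G B" "B \<subseteq> carrier G"
    and t: "t \<in> carrier G" and \<alpha>t: "\<alpha> t \<in> {t, inv t}"
  shows "t \<in> \<alpha> ` B \<longleftrightarrow> t \<in> B"
proof -
  interpret \<alpha>: group_hom G G \<alpha>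
    using \<alpha> by unfold_locales (simp add: auto_def)
  have inj: "inj_on \<alpha> (carrier G)"
    using \<alpha> by (simp add: auto_def Bij_def bij_betw_def)
  have inv_B: "inv x \<in> B" if "x \<in> B" for x
    using B that by (simp add: inverse_closed_def)
  show ?thesis
  proof (cases "\<alpha> t = t")
    case True
    with inj B t show ?thesis
      using inj_on_image_mem_iff by metis
  next
    case False
    with \<alpha>t t have "\<alpha> (inv t) = t" by simp
    with inj B t have "t \<in> \<alpha> ` B \<longleftrightarrow> inv t \<in> B"
      using inj_on_image_mem_iff[OF inj, of "inv t" B] by simp
    with inv_B t show ?thesis
      using inv_inv by metis
  qed
qed

lemma CI_group_not_has_k_if_property:
  assumes CI: "CI_group G" and t: "t \<in> nonidentity G"
    and \<alpha>t: "\<And>\<alpha>. \<alpha> \<in> auto G \<Longrightarrow> \<alpha> t \<in> {t, inv\<^bsub>G\<^esub> t}"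
    and k: "k \<ge> 2"
  shows "\<not> has_k_if_property k G"
proof
  assume "has_k_if_property k G"
  then obtain S P where P: "partition_on (nonidentity G) P" "finite P" "card P = k" "S \<in> P"
    and iso: "\<And>T. T \<in> P \<Longrightarrow> inverse_closed G T \<and> graph_iso (Cay G T) (Cay G S)"
    unfolding has_k_if_property_def k_if_Cayley_def by blast
  interpret group G using CI by (simp add: CI_group_def)
  have tG: "t \<in> carrier G" using t by (simp add: nonidentity_def)
  have sub: "T \<subseteq> nonidentity G" if "T \<in> P" for T
    using P(1) that by (auto simp: partition_on_def)
  have mem: "t \<in> T \<longleftrightarrow> t \<in> S" if T: "T \<in> P" for T
  proof -
    \<comment> \<open>The CI property is used from \<open>T\<close> to \<open>S\<close>, the
      direction in which the isomorphism is given.\<close>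
    obtain \<alpha> where \<alpha>: "\<alpha> \<in> auto G" "S = \<alpha> ` T"
      using CI iso[OF T] iso[OF P(4)] sub[OF T] sub[OF P(4)]
      unfolding CI_group_def by blast
    moreover have "T \<subseteq> carrier G"
      using sub[OF T] by (auto simp: nonidentity_def)
    ultimately show ?thesis
      using mem_auto_image_iff[OF \<alpha>(1) _ _ tG \<alpha>t[OF \<alpha>(1)]] iso[OF T] by simp
  qed
  \<comment> \<open>The blocks cover \<open>t\<close>, so one of them contains it; by
    \<open>mem\<close> all of them do, and disjointness makes them equal.\<close>
  obtain B where "B \<in> P" "t \<in> B"
    using P(1) t by (auto simp: partition_on_def)
  with mem have all: "t \<in> T" if "T \<in> P" for T using that by blast
  have "T = S" if "T \<in> P" for T
    using partition_onD2[OF P(1)] that P(4) all[OF that] all[OF P(4)]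
    by (auto dest: disjointD)
  then have "P \<subseteq> {S}" by blast
  then have "card P \<le> 1" using card_mono[of "{S}" P] by simp
  with P(3) k show False by simp
qed

text \<open>The order of the coset of \<open>x\<close> in \<open>G Mod H\<close> divides both
  \<open>p\<close> and the index of \<open>H\<close>. These are coprime, so the coset is
  trivial.\<close>

lemma (in comm_group) torsion_in_sylow_subgroup:
  assumes fin: "finite (carrier G)" and H: "sylow_subgroup p H G"
    and x: "x \<in> carrier G" "x [^] p = \<one>"
  shows "x \<in> H"
proof -
  have p: "Factorial_Ring.prime p" and sub: "subgroup H G"
    and card: "card H = p ^ multiplicity p (order G)"
    using H by (auto simp: sylow_subgroup_def)
  interpret normal H G using sub by (rule subgroup_imp_normal)
  interpret Q: group "G Mod H" by (rule factorgroup_is_group)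
  let ?y = "H #> x"
  have y: "?y \<in> carrier (G Mod H)"
    using r_coset_hom_Mod x(1) by (auto simp: hom_def)
  have "?y [^]\<^bsub>G Mod H\<^esub> p = H #> (x [^] p)"
    using hom_nat_pow[OF r_coset_hom_Mod x(1)] Q.is_group is_group by simp
  also have "\<dots> = \<one>\<^bsub>G Mod H\<^esub>"
    using x(2) hom_one[OF r_coset_hom_Mod is_group Q.is_group] by simp
  finally have dvd_p: "Q.ord ?y dvd p"
    using Q.pow_eq_id y by blast
  have ord_Q: "order G = order (G Mod H) * p ^ multiplicity p (order G)"
    using lagrange[OF sub] card by (simp add: order_def FactGroup_def)
  \<comment> \<open>For a nonzero order, \<open>p\<close> does not divide the cofactor of its full
    \<open>p\<close>-part, and here this cofactor is the index of \<open>H\<close>.\<close>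
  have "order G \<noteq> 0" using fin order_gt_0_iff_finite by auto
  then have "\<not> p dvd order (G Mod H)"
    using multiplicity_decompose[of "order G" p] p ord_Q
    by (metis not_prime_unit nonzero_mult_div_cancel_right mult_zero_right)
  moreover have "Q.ord ?y dvd order (G Mod H)"
    using Q.ord_dvd_group_order y by blast
  ultimately have "Q.ord ?y = 1"
    using dvd_p p by (metis prime_nat_iff)
  then have "?y = H"
    using Q.ord_eq_1[OF y] by (simp add: FactGroup_def)
  then show ?thesis using coset_join1 x(1) sub by blast
qed

text \<open>From \<open>n\<close> dividing \<open>p * a\<close> it follows that
  \<open>a = d * j\<close> with \<open>0 < j < p\<close>. As \<open>p\<close> is at most 3,
  \<open>j\<close> is 1 or \<open>p - 1\<close>, and \<open>(p - 1) * d = n - d\<close> represents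
  the inverse of \<open>d\<close>.\<close>

lemma integer_mod_group_torsion:
  fixes a :: int
  assumes "p = 2 \<or> p = 3" and "n = p * d" and "a \<in> carrier (integer_mod_group n)"
    and "a [^]\<^bsub>integer_mod_group n\<^esub> p = 0" and "a \<noteq> 0"
  shows "a = int d \<or> a = inv\<^bsub>integer_mod_group n\<^esub> (int d)"
proof -
  have p: "p > 0" using assms(1) by auto
  \<comment> \<open>If \<open>d = 0\<close>, the group is that of all integers, which has no nonzero
    torsion, contrary to \<open>a \<noteq> 0\<close>.\<close>
  have d: "d > 0" and a: "0 \<le> a" "a < int p * int d" "int p * int d dvd int p * a"
    using assms p by (auto simp: carrier_integer_mod_group split: if_splits)
  then have "int d dvd a" using p by simp
  then obtain j where j: "a = int d * j" ..
  have "0 < j" using j a(1) assms(5) d by (auto simp: zero_le_mult_iff)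
  moreover have "j < int p" using j a(2) d by (simp add: mult.commute)
  ultimately have *: "j = 1 \<or> (p = 3 \<and> j = 2)" using assms(1) by auto
  have dn: "int d \<in> carrier (integer_mod_group n)"
    using assms(1,2) d by (auto simp: carrier_integer_mod_group)
  have "(- int d) mod (int n) = int n - int d"
    using assms(1,2) d by (subst zmod_zminus1_eq_if) auto
  with * j dn assms(2) show ?thesis by auto
qed

text \<open>All solutions of \<open>x [^] p = \<one>\<close> lie in \<open>H\<close>, so they can be
  computed in the cyclic group, where \<open>d\<close> generates the subgroup of order
  \<open>p\<close>; \<open>t\<close> is the preimage of \<open>d\<close>.\<close>

lemma (in comm_group) torsion_of_cyclic_sylow_subgroup:
  assumes fin: "finite (carrier G)" and H: "sylow_subgroup p H G"
    and iso: "G\<lparr>carrier := H\<rparr> \<cong> integer_mod_group (p * d)"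
    and p: "p = 2 \<or> p = 3" and d: "d > 0"
  obtains t where "t \<in> carrier G" "t \<noteq> \<one>" "t [^] p = \<one>"
    "\<And>x. x \<in> carrier G \<Longrightarrow> x [^] p = \<one> \<Longrightarrow> x \<noteq> \<one> \<Longrightarrow> x \<in> {t, inv t}"
proof -
  let ?Z = "integer_mod_group (p * d)"
  have sub: "subgroup H G" using H by (simp add: sylow_subgroup_def)
  interpret H: subgroup H G by (rule sub)
  obtain f where f: "f \<in> hom (G\<lparr>carrier := H\<rparr>) ?Z" "bij_betw f H (carrier ?Z)"
    using iso by (auto simp: is_iso_def iso_def)
  interpret f: group_hom "G\<lparr>carrier := H\<rparr>" ?Z f
    using f(1) H.subgroup_is_group[OF is_group]
    by (simp add: group_hom_def group_hom_axioms_def)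
  have inj: "x = y" if "f x = f y" "x \<in> H" "y \<in> H" for x y
    using f(2) that by (auto simp: bij_betw_def inj_on_def)
  have f1: "f \<one> = 0" using f.hom_one by simp
  have pow: "f (x [^] p) = f x [^]\<^bsub>?Z\<^esub> p" if "x \<in> H" for x
    using f.hom_nat_pow[of x p] that nat_pow_consistent by simp
  have fc: "f x \<in> carrier ?Z" if "x \<in> H" for x
    using f(2) that by (auto simp: bij_betw_def)
  have "int d \<in> carrier ?Z"
    using p d by (auto simp: carrier_integer_mod_group)
  then obtain t where t: "t \<in> H" "f t = int d"
    using f(2) by (metis bij_betw_imp_surj_on imageE)
  have finv: "f (inv t) = inv\<^bsub>?Z\<^esub> (int d)"
    using f.hom_inv[of t] t m_inv_consistent[OF sub t(1)] by simp
  show thesis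
  proof (rule that)
    show "t \<in> carrier G" using t by simp
    show "t \<noteq> \<one>" using t f1 d by auto
    have "f (t [^] p) = f \<one>" using pow[OF t(1)] t(2) f1 by simp
    moreover have "t [^] p \<in> H"
      using t(1) by (induction p) auto
    ultimately show "t [^] p = \<one>" using inj[of "t [^] p" \<one>] by simp
  next
    fix x assume x: "x \<in> carrier G" "x [^] p = \<one>" "x \<noteq> \<one>"
    have xH: "x \<in> H" using torsion_in_sylow_subgroup[OF fin H x(1,2)] .
    have "f x \<noteq> 0" using inj[of x \<one>] xH f1 x(3) by auto
    moreover have "f x [^]\<^bsub>?Z\<^esub> p = 0" using pow[OF xH] x(2) f1 by simp
    ultimately have "f x = f t \<or> f x = f (inv t)"
      using integer_mod_group_torsion[OF p refl fc[OF xH]] t(2) finv by simp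
    then show "x \<in> {t, inv t}" using inj[of x t] inj[of x "inv t"] xH t(1) by auto
  qed
qed

theorem theorem4p3:
  fixes G :: "('a, 'b) monoid_scheme" and k :: nat
  assumes "comm_group G" and "finite (carrier G)" and "CI_group G"
    and "\<exists>p H. sylow_subgroup p H G \<and>
           (G\<lparr>carrier := H\<rparr> \<cong> integer_mod_group 4 \<or>
            G\<lparr>carrier := H\<rparr> \<cong> integer_mod_group 8 \<or>
            G\<lparr>carrier := H\<rparr> \<cong> integer_mod_group 9)"
    and "k \<ge> 2"
  shows "\<not> has_k_if_property k G"
proof -
  interpret comm_group G by fact
  obtain p H q where H: "sylow_subgroup p H G" and q: "q = 4 \<or> q = 8 \<or> q = (9::nat)"
    and iso: "G\<lparr>carrier := H\<rparr> \<cong> integer_mod_group q"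
    using assms(4) by blast
  have prime: "Factorial_Ring.prime p" using H by (simp add: sylow_subgroup_def)
  have "q = p ^ multiplicity p (order G)"
    using iso_same_card[OF iso] H q
    by (auto simp: sylow_subgroup_def carrier_integer_mod_group)
  \<comment> \<open>Exponent 0 would give \<open>q = 1\<close>.\<close>
  then have "p dvd q"
    using q by (cases "multiplicity p (order G)") auto
  moreover have "q = 2 ^ 2 \<or> q = 2 ^ 3 \<or> q = 3 ^ 2" using q by auto
  ultimately have "p dvd 2 \<or> p dvd 3"
    using prime_dvd_power[OF prime] by blast
  then have p: "p = 2 \<or> p = 3"
    using primes_dvd_imp_eq[OF prime] by auto
  obtain d where d: "q = p * d"
    using \<open>p dvd q\<close> ..
  then have "d > 0" using q by (auto intro: gr0I)
  obtain t where t: "t \<in> carrier G" "t \<noteq> \<one>\<^bsub>G\<^esub>" "t [^]\<^bsub>G\<^esub> p = \<one>\<^bsub>G\<^esub>"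
    "\<And>x. x \<in> carrier G \<Longrightarrow> x [^]\<^bsub>G\<^esub> p = \<one>\<^bsub>G\<^esub> \<Longrightarrow> x \<noteq> \<one>\<^bsub>G\<^esub> \<Longrightarrow> x \<in> {t, inv\<^bsub>G\<^esub> t}"
    using torsion_of_cyclic_sylow_subgroup[OF assms(2) H iso[unfolded d] p \<open>d > 0\<close>] by blast
  \<comment> \<open>An automorphism sends \<open>t\<close> to another nontrivial solution of
    \<open>x [^] p = \<one>\<close>, or to \<open>t\<close> itself, so the last property of
    \<open>t\<close> applies to the image.\<close>
  have "\<alpha> t \<in> {t, inv\<^bsub>G\<^esub> t}" if "\<alpha> \<in> auto G" for \<alpha>
  proof -
    interpret \<alpha>: group_hom G G \<alpha>
      using that by unfold_locales (simp add: auto_def)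
    have "inj_on \<alpha> (carrier G)"
      using that by (simp add: auto_def Bij_def bij_betw_def)
    then have "\<alpha> t \<noteq> \<one>\<^bsub>G\<^esub>"
      using t(1,2) \<alpha>.hom_one by (metis inj_onD one_closed)
    then show ?thesis
      using t \<alpha>.hom_nat_pow[OF t(1), of p] by simp
  qed
  with t(1,2) show ?thesis
    using CI_group_not_has_k_if_property[OF assms(3) _ _ assms(5)]
    by (simp add: nonidentity_def)
qed

end
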